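(* Define integers $T(k,\mu)$, for integers $k\ge1$ and $0\le\mu\le[(k-1)/2]$, recursively by $T(k,0)=1$ and $$T(k,\mu)=-\sum_{j=1}^{\mu}(-1)^j\binom{k-j}{j}T(k-2j,\mu-j)\qquad(1\le \mu\le[(k-1)/2]).$$ Then for every integer $k\ge1$ and every integer $0\le\mu\le[(k-1)/2]$, $$T(k,\mu)=\frac{k-2\mu+1}{k-\mu+1}\binom{k}{\mu}.$$
   Context: $[x]$ denotes the greatest integer $\le x$. *)

theory Defs
  imports Complex_Main
begin

text \<open>
  The intended domain is \<open>1 \<le> k\<close>, \<open>\<mu> \<le> (k - 1) div 2\<close>. It is closed under the recursive
  calls, and on it none of the natural-number subtractions below truncates. The values outside
  this domain are junk and are never used by the values inside it.
\<close>

function T :: "nat \<Rightarrow> nat \<Rightarrow> int" where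
  "T k \<mu> =
     (if \<mu> = 0 then 1
      else - (\<Sum>j = 1..\<mu>. (- 1) ^ j * int ((k - j) choose j) * T (k - 2 * j) (\<mu> - j)))"
  by pat_completeness auto
termination
  by (relation "measure snd") auto

declare T.simps [simp del]

end

theory Submission
  imports Defs
begin

text \<open>
  The claimed value is the ballot number \<open>B k \<mu> = C(k, \<mu>) - C(k, \<mu> - 1)\<close>, so it suffices that
  \<open>\<Sum>j\<le>\<mu>. (-1)^j C(k - j, j) B (k - 2j) (\<mu> - j) = 0\<close> for \<open>\<mu> \<ge> 1\<close>. Since
  \<open>C(k - j, j) C(k - 2j, \<mu> - j) = C(\<mu>, j) C(k - j, \<mu>)\<close>, the part of this sum coming from
  \<open>C(k, \<mu>)\<close> is the \<open>\<mu>\<close>-th finite difference of the polynomial \<open>x \<mapsto> C(x, \<mu>)\<close>, which is \<open>1\<close>.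
  The part coming from \<open>C(k, \<mu> - 1)\<close> is the same sum with \<open>\<mu> - 1\<close> for \<open>\<mu>\<close>, hence also \<open>1\<close>.
\<close>

text \<open>Pascal's rule on \<open>Suc m choose j\<close> followed by an index shift: a difference
  of order \<open>Suc m\<close> is one of order \<open>m\<close> applied to first
  differences.\<close>

lemma alternating_binomial_sum_Suc:
  fixes f :: "nat \<Rightarrow> int"
  shows "(\<Sum>j\<le>Suc m. (- 1) ^ j * int (Suc m choose j) * f j) =
         (\<Sum>j\<le>m. (- 1) ^ j * int (m choose j) * (f j - f (Suc j)))"
proof -
  let ?g = "\<lambda>j. (- 1) ^ j * int (m choose j) * f j"
  have "(\<Sum>j\<le>Suc m. (- 1) ^ j * int (Suc m choose j) * f j) =
        f 0 + (\<Sum>j\<le>m. ?g (Suc j) - (- 1) ^ j * int (m choose j) * f (Suc j))"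
    by (auto simp: sum.atMost_Suc_shift algebra_simps simp del: sum.atMost_Suc intro!: sum.cong)
  also have "\<dots> = (\<Sum>j\<le>Suc m. ?g j) - (\<Sum>j\<le>m. (- 1) ^ j * int (m choose j) * f (Suc j))"
    by (simp add: sum.atMost_Suc_shift sum_subtractf del: sum.atMost_Suc)
  also have "\<dots> = (\<Sum>j\<le>m. (- 1) ^ j * int (m choose j) * (f j - f (Suc j)))"
    by (simp add: sum_subtractf algebra_simps)
  finally show ?thesis .
qed

lemma alternating_binomial_sum_choose:
  "(\<Sum>j\<le>m. (- 1) ^ j * int (m choose j) * int ((m + a - j) choose (m + s))) = int (a choose s)"
proof (induction m)
  case 0
  show ?case by simp
next
  case (Suc m)
  have "(\<Sum>j\<le>Suc m. (- 1) ^ j * int (Suc m choose j) * int ((Suc m + a - j) choose (Suc m + s))) =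
    (\<Sum>j\<le>m. (- 1) ^ j * int (m choose j) *
      (int ((Suc m + a - j) choose (Suc m + s)) - int ((Suc m + a - Suc j) choose (Suc m + s))))"
    by (rule alternating_binomial_sum_Suc)
  \<comment> \<open>Pascal's rule again, now on the upper argument; \<open>a\<close> and
    \<open>s\<close> stay fixed.\<close>
  also have "\<dots> = (\<Sum>j\<le>m. (- 1) ^ j * int (m choose j) * int ((m + a - j) choose (m + s)))"
    by (intro sum.cong refl) (simp add: Suc_diff_le)
  finally show ?case using Suc by simp
qed

lemma alternating_trinomial_sum:
  assumes "2 * m \<le> k"
  shows "(\<Sum>j\<le>m. (- 1) ^ j * int ((k - j) choose j) * int ((k - 2 * j) choose (m - j))) = 1"
proof -
  \<comment> \<open>Both sides count the \<open>j\<close>-subsets of \<open>m\<close>-subsets of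
    \<open>k - j\<close> points; \<open>m \<le> k - j\<close> follows from
    \<open>2 * m \<le> k\<close>.\<close>
  have "((k - j) choose j) * ((k - 2 * j) choose (m - j)) = (m choose j) * ((k - j) choose m)"
    if "j \<le> m" for j
    using choose_mult[of j m "k - j"] that assms by (simp add: mult_2 mult.commute[of "m choose j"])
  then have "(\<Sum>j\<le>m. (- 1) ^ j * int ((k - j) choose j) * int ((k - 2 * j) choose (m - j))) =
        (\<Sum>j\<le>m. (- 1) ^ j * int (m choose j) * int ((k - j) choose m))"
    by (intro sum.cong refl) (simp add: mult.assoc flip: of_nat_mult)
  also have "\<dots> = 1"
    using alternating_binomial_sum_choose[of m "k - m" 0] assms by simp
  finally show ?thesis .
qed

text \<open>The case split is needed because \<open>m - 1\<close> truncates at \<open>m = 0\<close>,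
  where \<open>k choose (m - 1)\<close> would be 1 instead of 0.\<close>

definition ballot :: "nat \<Rightarrow> nat \<Rightarrow> int" where
  "ballot k m = int (k choose m) - (if m = 0 then 0 else int (k choose (m - 1)))"

lemma alternating_ballot_sum:
  assumes "2 * m \<le> k" and "m > 0"
  shows "(\<Sum>j\<le>m. (- 1) ^ j * int ((k - j) choose j) * ballot (k - 2 * j) (m - j)) = 0"
proof -
  obtain n where m: "m = Suc n"
    using \<open>m > 0\<close> gr0_implies_Suc by blast
  let ?c = "\<lambda>j. (- 1) ^ j * int ((k - j) choose j)"
  have "(\<Sum>j\<le>m. ?c j * ballot (k - 2 * j) (m - j)) =
        (\<Sum>j\<le>m. ?c j * int ((k - 2 * j) choose (m - j))) -
        (\<Sum>j\<le>m. ?c j * (if m - j = 0 then 0 else int ((k - 2 * j) choose (m - j - 1))))"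
    by (simp add: ballot_def right_diff_distrib sum_subtractf del: sum.atMost_Suc)
  \<comment> \<open>The term \<open>j = m\<close> vanishes, and \<open>m - j - 1 = n - j\<close> in
    the others.\<close>
  also have "(\<Sum>j\<le>m. ?c j * (if m - j = 0 then 0 else int ((k - 2 * j) choose (m - j - 1)))) =
             (\<Sum>j\<le>n. ?c j * int ((k - 2 * j) choose (n - j)))"
    unfolding m by (auto intro!: sum.cong)
  finally show ?thesis
    using alternating_trinomial_sum[of m k] alternating_trinomial_sum[of n k] assms m by simp
qed

lemma T_eq_ballot:
  assumes "2 * m \<le> k"
  shows "T k m = ballot k m"
  using assms
proof (induction m arbitrary: k rule: less_induct)
  case (less m)
  show ?case
  proof (cases "m = 0")
    case True
    then show ?thesis by (simp add: T.simps ballot_def)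
  next
    case False
    let ?g = "\<lambda>j. (- 1) ^ j * int ((k - j) choose j) * ballot (k - 2 * j) (m - j)"
    have "T k m = - (\<Sum>j = 1..m. (- 1) ^ j * int ((k - j) choose j) * T (k - 2 * j) (m - j))"
      using False by (subst T.simps) simp
    also have "\<dots> = - (\<Sum>j = 1..m. ?g j)"
      \<comment> \<open>The bound is inherited: \<open>2 * (m - j) \<le> k - 2 * j\<close>.\<close>
      using less by (intro arg_cong[of _ _ uminus] sum.cong refl) auto
    also have "\<dots> = ?g 0 - (\<Sum>j\<le>m. ?g j)"
      by (simp add: atMost_atLeast0 sum.atLeast_Suc_atMost)
    also have "\<dots> = ballot k m"
      using alternating_ballot_sum[of m k] less.prems False by simp
    finally show ?thesis .
  qed
qed

text \<open>For \<open>m > 0\<close>, absorption gives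
  \<open>(k - m + 1) * (k choose (m - 1)) = m * (k choose m)\<close>, so the difference is
  \<open>1 - m / (k - m + 1)\<close> times \<open>k choose m\<close>.\<close>

lemma ballot_closed_form:
  assumes "m \<le> k"
  shows "real_of_int (ballot k m) =
         (real k - 2 * real m + 1) / (real k - real m + 1) * real (k choose m)"
proof (cases m)
  case 0
  then show ?thesis by (simp add: ballot_def)
next
  case (Suc n)
  have "(k - n) * (k choose n) = Suc n * (k choose Suc n)"
    using binomial_absorb_comp[of k n] binomial_absorption[of n k] by simp
  then have "real (k - n) * real (k choose n) = real (Suc n) * real (k choose Suc n)"
    by (metis of_nat_mult)
  then have "(real k - real n) * real (k choose n) = real m * real (k choose m)"
    using assms Suc by (simp add: of_nat_diff)
  moreover have "real k - real n \<noteq> 0"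
    using assms Suc by simp
  ultimately show ?thesis
    using Suc by (simp add: ballot_def field_simps)
qed

theorem theorem2p3:
  fixes k \<mu> :: nat
  assumes "k \<ge> 1" and "\<mu> \<le> (k - 1) div 2"
  shows "real_of_int (T k \<mu>) =
           (real k - 2 * real \<mu> + 1) / (real k - real \<mu> + 1) * real (k choose \<mu>)"
  using T_eq_ballot[of \<mu> k] ballot_closed_form[of \<mu> k] assms by simp

end
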